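(* For all integers $d\ge 1$ and $n\ge 1$, $$\mathsf{p}_d(n) \le n^d\,\mathsf{p}(\underbrace{n,\ldots,n}_{d\text{ times}}).$$
   Context: A $d$-dimensional partition is an array $\pi = (\pi_{i_1,\ldots,i_d})_{i_1,\ldots,i_d\ge 1}$ of nonnegative integers with only finitely many nonzero entries such that $\pi_{i_1,\ldots,i_d}\ge \pi_{j_1,\ldots,j_d}$ whenever $i_1\le j_1,\ldots,i_d\le j_d$. Its volume is $|\pi| = \sum_{i_1,\ldots,i_d}\pi_{i_1,\ldots,i_d}$. $\mathsf{p}_d(n)$ denotes the number of $d$-dimensional partitions of volume $n$. The vector partition numbers $\mathsf{p}(n_1,\ldots,n_d)$ (for nonnegative integers $n_1,\ldots,n_d$) are defined by the formal power series identity $$\sum_{n_1,\ldots,n_d\ge 0}\mathsf{p}(n_1,\ldots,n_d)\,x_1^{n_1}\cdots x_d^{n_d} = \prod_{i_1,\ldots,i_d\ge1}\left(1-x_1^{i_1}\cdots x_d^{i_d}\right)^{-1}$$ (note that all exponents $i_1,\ldots,i_d$ in the product are at least $1$). *)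

theory Defs
  imports "HOL-Library.Poly_Mapping" "HOL-Library.FuncSet"
begin

section \<open>Formal power series in several variables\<close>

text \<open>
  A monomial is an exponent vector \<open>m :: nat \<Rightarrow>\<^sub>0 nat\<close>, where \<open>Poly_Mapping.lookup m k\<close> is the exponent of
  \<open>x\<^sub>k\<close>. The variables are numbered from 0, and a series in \<open>d\<close> variables is one that only
  involves \<open>x\<^sub>k\<close> for \<open>k < d\<close>.
\<close>

typedef 'a mfps = "UNIV :: ((nat \<Rightarrow>\<^sub>0 nat) \<Rightarrow> 'a) set"
  morphisms mfps_coeff Abs_mfps
  by simp

lemma mfps_coeff_Abs [simp]: "mfps_coeff (Abs_mfps f) m = f m"
  by (simp add: Abs_mfps_inverse)

lemma mfps_eqI: "(\<And>m. mfps_coeff f m = mfps_coeff g m) \<Longrightarrow> f = g"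
  by (metis ext mfps_coeff_inject)

lemma finite_decompositions:
  fixes m :: "nat \<Rightarrow>\<^sub>0 nat"
  shows "finite {(a, b). a + b = m}"
proof -
  let ?r = "\<lambda>(a, b :: nat \<Rightarrow>\<^sub>0 nat). restrict (Poly_Mapping.lookup a) (Poly_Mapping.keys m)"
  have le: "Poly_Mapping.lookup a k \<le> Poly_Mapping.lookup m k" if "a + b = m" for a b k
    using that by (auto simp: lookup_add)
  have "?r ` {(a, b). a + b = m} \<subseteq> (\<Pi>\<^sub>E k\<in>Poly_Mapping.keys m. {..Poly_Mapping.lookup m k})"
    using le by auto
  then have "finite (?r ` {(a, b). a + b = m})"
    by (rule finite_subset) (auto intro!: finite_PiE)
  moreover have "inj_on ?r {(a, b). a + b = m}"
  proof (rule inj_onI, clarify)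
    fix a b a' b'
    assume m: "m = a + b" and eq: "a' + b' = a + b"
      and r: "restrict (Poly_Mapping.lookup a) (Poly_Mapping.keys (a + b)) = restrict (Poly_Mapping.lookup a') (Poly_Mapping.keys (a + b))"
    have "Poly_Mapping.lookup a k = Poly_Mapping.lookup a' k" for k
    proof (cases "k \<in> Poly_Mapping.keys m")
      case True
      then show ?thesis using r m by (metis restrict_apply')
    next
      case False
      then have "Poly_Mapping.lookup m k = 0" by (simp add: in_keys_iff)
      then show ?thesis using le[of a b k] le[of a' b' k] m eq by simp
    qed
    then have "a = a'" by (intro poly_mapping_eqI)
    then show "a = a' \<and> b = b'" using eq by simp
  qed
  ultimately show ?thesis by (rule finite_imageD)
qed

lemma sum_decompositions_single:
  fixes m :: "nat \<Rightarrow>\<^sub>0 nat" and h :: "_ \<Rightarrow> _ \<Rightarrow> 'a::comm_monoid_add"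
  assumes "c + e = m" and "\<And>a b. a + b = m \<Longrightarrow> a \<noteq> c \<Longrightarrow> h a b = 0"
  shows "(\<Sum>(a, b)\<in>{(a, b). a + b = m}. h a b) = h c e"
proof -
  have "(\<Sum>(a, b)\<in>{(a, b). a + b = m}. h a b) = (\<Sum>(a, b)\<in>{(c, e)}. h a b)"
  proof (rule sum.mono_neutral_right)
    show "\<forall>p\<in>{(a, b). a + b = m} - {(c, e)}. (case p of (a, b) \<Rightarrow> h a b) = 0"
    proof
      fix p assume "p \<in> {(a, b). a + b = m} - {(c, e)}"
      then obtain a b where p: "p = (a, b)" and ab: "a + b = m" and ne: "(a, b) \<noteq> (c, e)"
        by blast
      have "a \<noteq> c" using ne ab assms(1) by auto
      then show "(case p of (a, b) \<Rightarrow> h a b) = 0"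
        using assms(2)[OF ab] by (simp add: p)
    qed
  qed (use assms(1) in \<open>auto simp: finite_decompositions\<close>)
  then show ?thesis by simp
qed

instantiation mfps :: (comm_ring_1) comm_ring_1
begin

definition zero_mfps :: "'a mfps" where
  "0 = Abs_mfps (\<lambda>m. 0)"

definition one_mfps :: "'a mfps" where
  "1 = Abs_mfps (\<lambda>m. if m = 0 then 1 else 0)"

definition plus_mfps :: "'a mfps \<Rightarrow> 'a mfps \<Rightarrow> 'a mfps" where
  "f + g = Abs_mfps (\<lambda>m. mfps_coeff f m + mfps_coeff g m)"

definition minus_mfps :: "'a mfps \<Rightarrow> 'a mfps \<Rightarrow> 'a mfps" where
  "f - g = Abs_mfps (\<lambda>m. mfps_coeff f m - mfps_coeff g m)"

definition uminus_mfps :: "'a mfps \<Rightarrow> 'a mfps" where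
  "- f = Abs_mfps (\<lambda>m. - mfps_coeff f m)"

definition times_mfps :: "'a mfps \<Rightarrow> 'a mfps \<Rightarrow> 'a mfps" where
  "f * g = Abs_mfps (\<lambda>m. \<Sum>(a, b)\<in>{(a, b). a + b = m}. mfps_coeff f a * mfps_coeff g b)"

instance
proof
  fix f g h :: "'a mfps"
  show "f * g * h = f * (g * h)"
  proof (rule mfps_eqI)
    fix m
    let ?D = "\<lambda>m::nat \<Rightarrow>\<^sub>0 nat. {(a, b). a + b = m}"
    have "mfps_coeff (f * g * h) m =
        (\<Sum>(s, c)\<in>?D m. \<Sum>(a, b)\<in>?D s. mfps_coeff f a * mfps_coeff g b * mfps_coeff h c)"
      by (simp add: times_mfps_def sum_distrib_right case_prod_unfold)
    also have "\<dots> = (\<Sum>((s, c), (a, b))\<in>Sigma (?D m) (\<lambda>(s, c). ?D s).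
        mfps_coeff f a * mfps_coeff g b * mfps_coeff h c)"
      by (subst sum.Sigma[symmetric])
        (auto simp: finite_decompositions finite_decompositions[unfolded case_prod_unfold]
          case_prod_unfold)
    also have "\<dots> = (\<Sum>((a, s), (b, c))\<in>Sigma (?D m) (\<lambda>(a, s). ?D s).
        mfps_coeff f a * mfps_coeff g b * mfps_coeff h c)"
      by (rule sum.reindex_bij_witness[of _ "\<lambda>((a, s), (b, c)). ((a + b, c), (a, b))"
            "\<lambda>((s, c), (a, b)). ((a, b + c), (b, c))"]) (auto simp: add.assoc)
    also have "\<dots> = (\<Sum>(a, s)\<in>?D m. \<Sum>(b, c)\<in>?D s.
        mfps_coeff f a * mfps_coeff g b * mfps_coeff h c)"
      by (subst sum.Sigma[symmetric])
        (auto simp: finite_decompositions finite_decompositions[unfolded case_prod_unfold]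
          case_prod_unfold)
    also have "\<dots> = mfps_coeff (f * (g * h)) m"
      by (simp add: times_mfps_def sum_distrib_left case_prod_unfold mult.assoc)
    finally show "mfps_coeff (f * g * h) m = mfps_coeff (f * (g * h)) m" .
  qed
  show "f * g = g * f"
  proof (rule mfps_eqI)
    fix m
    show "mfps_coeff (f * g) m = mfps_coeff (g * f) m"
      unfolding times_mfps_def mfps_coeff_Abs
      by (rule sum.reindex_bij_witness[of _ prod.swap prod.swap])
        (auto simp: add.commute mult.commute)
  qed
  show "1 * f = f"
  proof (rule mfps_eqI)
    fix m
    have "mfps_coeff (1 * f) m =
        (\<Sum>(a, b)\<in>{(a, b). a + b = m}. (if a = 0 then 1 else 0) * mfps_coeff f b)"
      by (simp add: times_mfps_def one_mfps_def)
    also have "\<dots> = mfps_coeff f m"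
      by (subst sum_decompositions_single[of 0 m]) auto
    finally show "mfps_coeff (1 * f) m = mfps_coeff f m" .
  qed
  show "(f + g) * h = f * h + g * h"
    by (rule mfps_eqI)
      (simp add: times_mfps_def plus_mfps_def distrib_right case_prod_unfold sum.distrib)
  have "mfps_coeff (0 :: 'a mfps) 0 \<noteq> mfps_coeff 1 0"
    by (simp add: zero_mfps_def one_mfps_def)
  then show "(0 :: 'a mfps) \<noteq> 1" by metis
qed (auto intro!: mfps_eqI simp: zero_mfps_def plus_mfps_def minus_mfps_def uminus_mfps_def
       algebra_simps)

end

definition mfps_monom :: "(nat \<Rightarrow>\<^sub>0 nat) \<Rightarrow> 'a::comm_ring_1 mfps" where
  "mfps_monom i = Abs_mfps (\<lambda>m. if m = i then 1 else 0)"

definition mfps_inverse :: "'a::comm_ring_1 mfps \<Rightarrow> 'a mfps" where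
  "mfps_inverse f = (THE g. f * g = 1)"

text \<open>
  Convergence of an infinite product in the usual topology of formal power series:
  every coefficient of the finite partial products is eventually constant.
\<close>

definition has_mfps_prod ::
    "('i \<Rightarrow> 'a::comm_ring_1 mfps) \<Rightarrow> 'i set \<Rightarrow> 'a mfps \<Rightarrow> bool" where
  "has_mfps_prod f I P \<longleftrightarrow>
     (\<forall>m. \<forall>\<^sub>F F in finite_subsets_at_top I. mfps_coeff (\<Prod>i\<in>F. f i) m = mfps_coeff P m)"

definition mfps_infprod :: "('i \<Rightarrow> 'a::comm_ring_1 mfps) \<Rightarrow> 'i set \<Rightarrow> 'a mfps" where
  "mfps_infprod f I = (THE P. has_mfps_prod f I P)"

lemma mfps_inverse_eqI:
  assumes "f * g = 1"
  shows "mfps_inverse f = g"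
  unfolding mfps_inverse_def
proof (rule the_equality)
  show "f * g = 1" by fact
next
  fix h assume "f * h = 1"
  then have "g * (f * h) = g" by simp
  then show "h = g" using assms by (simp add: mult.assoc[symmetric] mult.commute)
qed

lemma mfps_infprod_eqI:
  assumes "has_mfps_prod f I P"
  shows "mfps_infprod f I = P"
  unfolding mfps_infprod_def
proof (rule the_equality)
  show "has_mfps_prod f I P" by fact
next
  fix Q assume Q: "has_mfps_prod f I Q"
  show "Q = P"
  proof (rule mfps_eqI)
    fix m
    have "\<forall>\<^sub>F F in finite_subsets_at_top I. mfps_coeff Q m = mfps_coeff P m"
      using Q[unfolded has_mfps_prod_def, rule_format, of m]
        assms[unfolded has_mfps_prod_def, rule_format, of m]
      by eventually_elim simp
    then show "mfps_coeff Q m = mfps_coeff P m" by simp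
  qed
qed

section \<open>Higher-dimensional partitions and vector partition numbers\<close>

text \<open>
  \<open>pos_index d\<close> is the set of \<open>d\<close>-tuples \<open>(i\<^sub>1, \<dots>, i\<^sub>d)\<close> of integers \<open>\<ge> 1\<close>, with the coordinates
  stored at positions \<open>0, \<dots>, d - 1\<close>. It serves both as the index set of the arrays and
  as the set of exponents in the product that defines the vector partition numbers.
\<close>

definition pos_index :: "nat \<Rightarrow> (nat \<Rightarrow>\<^sub>0 nat) set" where
  "pos_index d = {i. (\<forall>k<d. Poly_Mapping.lookup i k \<ge> 1) \<and> (\<forall>k\<ge>d. Poly_Mapping.lookup i k = 0)}"

text \<open>
  An array is a function that vanishes outside \<open>pos_index d\<close>, so that distinct functions
  represent distinct arrays. The order that \<open>Poly_Mapping\<close> puts on exponent vectors is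
  lexicographic; the componentwise one is therefore spelled out.
\<close>

definition is_dim_partition :: "nat \<Rightarrow> ((nat \<Rightarrow>\<^sub>0 nat) \<Rightarrow> nat) \<Rightarrow> bool" where
  "is_dim_partition d p \<longleftrightarrow>
     (\<forall>i. i \<notin> pos_index d \<longrightarrow> p i = 0) \<and>
     finite {i. p i \<noteq> 0} \<and>
     (\<forall>i\<in>pos_index d. \<forall>j\<in>pos_index d.
        (\<forall>k<d. Poly_Mapping.lookup i k \<le> Poly_Mapping.lookup j k) \<longrightarrow> p i \<ge> p j)"

definition volume :: "((nat \<Rightarrow>\<^sub>0 nat) \<Rightarrow> nat) \<Rightarrow> nat" where
  "volume p = (\<Sum>i | p i \<noteq> 0. p i)"

definition num_dim_partitions :: "nat \<Rightarrow> nat \<Rightarrow> nat" where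
  "num_dim_partitions d n = card {p. is_dim_partition d p \<and> volume p = n}"

lemma finite_dim_partitions: "finite {p. is_dim_partition d p \<and> volume p = n}"
proof -
  define B where "B = {i \<in> pos_index d. \<forall>k<d. Poly_Mapping.lookup i k \<le> n}"
  have "finite B"
  proof (rule finite_imageD)
    have "(\<lambda>i. restrict (Poly_Mapping.lookup i) {..<d}) ` B \<subseteq> (\<Pi>\<^sub>E k\<in>{..<d}. {..n})"
      by (auto simp: B_def split: if_splits)
    then show "finite ((\<lambda>i. restrict (Poly_Mapping.lookup i) {..<d}) ` B)"
      by (rule finite_subset) (auto intro!: finite_PiE)
    show "inj_on (\<lambda>i. restrict (Poly_Mapping.lookup i) {..<d}) B"
    proof (rule inj_onI)
      fix i j assume ij: "i \<in> B" "j \<in> B"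
        and eq: "restrict (Poly_Mapping.lookup i) {..<d} = restrict (Poly_Mapping.lookup j) {..<d}"
      have "Poly_Mapping.lookup i k = Poly_Mapping.lookup j k" for k
      proof (cases "k < d")
        case True
        then show ?thesis using fun_cong[OF eq, of k] by simp
      next
        case False
        then show ?thesis using ij by (simp add: B_def pos_index_def)
      qed
      then show "i = j" by (intro poly_mapping_eqI)
    qed
  qed
  then have "finite {p. \<forall>i. (i \<in> B \<longrightarrow> p i \<in> {..n}) \<and> (i \<notin> B \<longrightarrow> p i = 0)}"
    by (rule finite_set_of_finite_funs) simp
  moreover have "(i \<in> B \<longrightarrow> p i \<in> {..n}) \<and> (i \<notin> B \<longrightarrow> p i = 0)"
    if p: "is_dim_partition d p" and vol: "volume p = n" for p i
  proof (cases "p i = 0")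
    case False
    let ?supp = "{i. p i \<noteq> 0}"
    have fin: "finite ?supp" using p by (simp add: is_dim_partition_def)
    have i: "i \<in> pos_index d" using p False by (auto simp: is_dim_partition_def)
    have "p i \<le> n"
      unfolding vol[symmetric] volume_def using False fin by (intro member_le_sum) auto
    moreover have "Poly_Mapping.lookup i k \<le> n" if k: "k < d" for k
    proof -
      let ?u = "\<lambda>t. Poly_Mapping.update k t i"
      have inj: "inj_on ?u {1..Poly_Mapping.lookup i k}"
        by (rule inj_onI) (metis lookup_update)
      have sub: "?u ` {1..Poly_Mapping.lookup i k} \<subseteq> ?supp"
      proof (rule image_subsetI)
        fix t assume t: "t \<in> {1..Poly_Mapping.lookup i k}"
        have "?u t \<in> pos_index d" using i t k by (auto simp: pos_index_def lookup_update)
        moreover have "\<forall>l<d. Poly_Mapping.lookup (?u t) l \<le> Poly_Mapping.lookup i l"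
          using t by (auto simp: lookup_update)
        ultimately have "p (?u t) \<ge> p i" using p i unfolding is_dim_partition_def by blast
        then show "?u t \<in> ?supp" using False by simp
      qed
      have "Poly_Mapping.lookup i k = card (?u ` {1..Poly_Mapping.lookup i k})"
        unfolding card_image[OF inj] by simp
      also have "\<dots> \<le> card ?supp" by (rule card_mono[OF fin sub])
      also have "\<dots> = (\<Sum>i\<in>?supp. 1)" by simp
      also have "\<dots> \<le> volume p" unfolding volume_def by (rule sum_mono) auto
      finally show ?thesis using vol by simp
    qed
    ultimately show ?thesis using i by (auto simp: B_def)
  qed simp
  ultimately show ?thesis by (elim finite_subset[rotated]) blast
qed

definition vector_partition_series :: "nat \<Rightarrow> int mfps" where
  "vector_partition_series d =
     mfps_infprod (\<lambda>i. mfps_inverse (1 - mfps_monom i)) (pos_index d)"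

text \<open>For \<open>d \<ge> 1\<close> the factors are invertible and the product converges.\<close>

lemma mfps_geometric:
  fixes i :: "nat \<Rightarrow>\<^sub>0 nat"
  assumes "i \<noteq> 0"
  defines "S \<equiv> {m. \<exists>k. m = (((+) i) ^^ k) 0}"
  defines "G \<equiv> Abs_mfps (\<lambda>m. if m \<in> S then 1 else 0 :: 'a::comm_ring_1)"
  shows "(1 - mfps_monom i) * G = 1"
proof (rule mfps_eqI)
  fix m :: "nat \<Rightarrow>\<^sub>0 nat"
  let ?D = "{(a, b). a + b = m}"
  have G: "mfps_coeff G b = (if b \<in> S then 1 else 0)" for b
    by (simp add: G_def)
  have shift: "(\<Sum>(a, b)\<in>?D. if a = i then mfps_coeff G b else 0) =
      (if \<exists>b\<in>S. i + b = m then 1 else 0)"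
  proof (cases "\<exists>b. i + b = m")
    case True
    then obtain b where b: "i + b = m" by blast
    have "(\<Sum>(a, b)\<in>?D. if a = i then mfps_coeff G b else 0) = mfps_coeff G b"
      by (subst sum_decompositions_single[OF b]) auto
    moreover have "(\<exists>b\<in>S. i + b = m) \<longleftrightarrow> b \<in> S"
      using b by (metis add_left_imp_eq)
    ultimately show ?thesis by (simp add: G)
  next
    case False
    have "(\<Sum>(a, b)\<in>?D. if a = i then mfps_coeff G b else 0) = 0"
      using False by (intro sum.neutral) auto
    then show ?thesis using False by auto
  qed
  have zero: "0 \<in> S"
    unfolding S_def by (rule CollectI, rule exI[of _ 0]) simp
  have Suc: "i + b \<in> S" if "b \<in> S" for b
  proof -
    from that obtain k where "b = (((+) i) ^^ k) 0" by (auto simp: S_def)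
    then have "i + b = (((+) i) ^^ Suc k) 0" by simp
    then show ?thesis unfolding S_def by blast
  qed
  have inv: "m = 0 \<or> (\<exists>b\<in>S. i + b = m)" if "m \<in> S"
  proof -
    from that obtain k where k: "m = (((+) i) ^^ k) 0" by (auto simp: S_def)
    show ?thesis
    proof (cases k)
      case (Suc l)
      then have "i + (((+) i) ^^ l) 0 = m" using k by simp
      moreover have "(((+) i) ^^ l) 0 \<in> S" unfolding S_def by blast
      ultimately show ?thesis by blast
    qed (use k in simp)
  qed
  have ne: "i + b \<noteq> 0" for b
  proof
    assume "i + b = 0"
    then have "Poly_Mapping.lookup i k = 0" for k
      by (metis add_is_0 lookup_add lookup_zero)
    then show False using assms(1) by (simp add: poly_mapping_eqI)
  qed
  have "mfps_coeff ((1 - mfps_monom i) * G) m =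
      (\<Sum>(a, b)\<in>?D. ((if a = 0 then 1 else 0) - (if a = i then 1 else 0)) * mfps_coeff G b)"
    by (simp add: times_mfps_def minus_mfps_def one_mfps_def mfps_monom_def)
  also have "\<dots> = (\<Sum>(a, b)\<in>?D. if a = 0 then mfps_coeff G b else 0) -
      (\<Sum>(a, b)\<in>?D. if a = i then mfps_coeff G b else 0)"
    unfolding sum_subtractf[symmetric] using assms(1) by (intro sum.cong) auto
  also have "(\<Sum>(a, b)\<in>?D. if a = 0 then mfps_coeff G b else 0) = mfps_coeff G m"
    by (subst sum_decompositions_single[of 0 m]) auto
  also have "mfps_coeff G m - (\<Sum>(a, b)\<in>?D. if a = i then mfps_coeff G b else 0) =
      (if m = 0 then 1 else 0)"
  proof (cases "m = 0")
    case True
    then have "\<not> (\<exists>b\<in>S. i + b = m)" using ne by blast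
    then show ?thesis unfolding shift using True zero by (simp add: G)
  next
    case False
    then have "m \<in> S \<longleftrightarrow> (\<exists>b\<in>S. i + b = m)" using inv Suc by blast
    then show ?thesis unfolding shift using False by (simp add: G)
  qed
  finally show "mfps_coeff ((1 - mfps_monom i) * G) m = mfps_coeff 1 m"
    by (simp add: one_mfps_def)
qed

lemma mult_mfps_inverse:
  assumes "i \<noteq> 0"
  shows "(1 - mfps_monom i) * mfps_inverse (1 - mfps_monom i) = 1"
  using mfps_geometric[OF assms] mfps_inverse_eqI by metis

lemma vector_partition_series:
  assumes "d \<ge> 1"
  shows "has_mfps_prod (\<lambda>i. mfps_inverse (1 - mfps_monom i)) (pos_index d)
           (vector_partition_series d)"
proof -
  let ?g = "\<lambda>i. mfps_inverse (1 - mfps_monom i) :: int mfps"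
  define F0 where "F0 m = {i \<in> pos_index d. \<exists>c. i + c = m}" for m
  have fin: "finite (F0 m)" for m
  proof (rule finite_subset)
    show "F0 m \<subseteq> fst ` {(a, b). a + b = m}" by (auto simp: F0_def image_iff)
  qed (simp add: finite_decompositions)
  have step: "mfps_coeff (?g i * P) m = mfps_coeff P m" if i: "i \<in> pos_index d" "i \<notin> F0 m" for i P m
  proof -
    have i0: "i \<noteq> 0" using i(1) assms by (auto simp: pos_index_def)
    let ?S = "{m. \<exists>k. m = (((+) i) ^^ k) 0}"
    have g: "mfps_coeff (?g i) a = (if a \<in> ?S then 1 else 0)" for a
      unfolding mfps_inverse_eqI[OF mfps_geometric[OF i0]] by (rule mfps_coeff_Abs)
    have zero: "mfps_coeff (?g i) a = 0" if ab: "a + b = m" "a \<noteq> 0" for a b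
    proof -
      have "a \<noteq> (((+) i) ^^ k) 0" for k
      proof (cases k)
        case (Suc l)
        show ?thesis
        proof
          assume "a = (((+) i) ^^ k) 0"
          then have "i + ((((+) i) ^^ l) 0 + b) = m" using ab Suc by (simp add: add.assoc)
          then show False using i unfolding F0_def by blast
        qed
      qed (use ab in simp)
      then have "a \<notin> ?S" by blast
      then show ?thesis unfolding g by (rule if_not_P)
    qed
    have "0 \<in> ?S" by (rule CollectI, rule exI[of _ 0]) simp
    then have one: "mfps_coeff (?g i) 0 = 1" unfolding g by (rule if_P)
    have "mfps_coeff (?g i * P) m = (\<Sum>(a, b)\<in>{(a, b). a + b = m}. mfps_coeff (?g i) a * mfps_coeff P b)"
      by (simp add: times_mfps_def)
    also have "\<dots> = mfps_coeff (?g i) 0 * mfps_coeff P m"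
      by (rule sum_decompositions_single) (use zero in auto)
    finally show ?thesis by (simp add: one)
  qed
  have stable: "mfps_coeff (\<Prod>i\<in>H \<union> F0 m. ?g i) m = mfps_coeff (\<Prod>i\<in>F0 m. ?g i) m"
    if "finite H" "H \<subseteq> pos_index d" for H m
    using that
  proof (induction H rule: finite_induct)
    case (insert i H)
    show ?case
    proof (cases "i \<in> F0 m")
      case True
      then show ?thesis using insert by (simp add: insert_absorb)
    next
      case False
      then have "(\<Prod>i\<in>insert i H \<union> F0 m. ?g i) = ?g i * (\<Prod>i\<in>H \<union> F0 m. ?g i)"
        using insert.hyps fin by simp
      then show ?thesis using insert step False by simp
    qed
  qed simp
  have P: "has_mfps_prod ?g (pos_index d) (Abs_mfps (\<lambda>m. mfps_coeff (\<Prod>i\<in>F0 m. ?g i) m))"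
    unfolding has_mfps_prod_def mfps_coeff_Abs
  proof
    fix m
    show "\<forall>\<^sub>F F in finite_subsets_at_top (pos_index d).
        mfps_coeff (\<Prod>i\<in>F. ?g i) m = mfps_coeff (\<Prod>i\<in>F0 m. ?g i) m"
      unfolding eventually_finite_subsets_at_top
    proof (intro exI[of _ "F0 m"] conjI allI impI)
      show "F0 m \<subseteq> pos_index d" by (auto simp: F0_def)
      fix Y assume "finite Y \<and> F0 m \<subseteq> Y \<and> Y \<subseteq> pos_index d"
      then show "mfps_coeff (\<Prod>i\<in>Y. ?g i) m = mfps_coeff (\<Prod>i\<in>F0 m. ?g i) m"
        using stable[of Y m] by (simp add: Un_absorb2)
    qed (rule fin)
  qed
  show ?thesis
    unfolding vector_partition_series_def mfps_infprod_eqI[OF P] by (rule P)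
qed

text \<open>
  \<open>Poly_Mapping.nth ns\<close> is the exponent vector of \<open>x\<^sub>0\<^bsup>ns!0\<^esup> x\<^sub>1\<^bsup>ns!1\<^esup> \<cdots>\<close>; the number of
  variables is the length of the list.
\<close>

definition vector_partition_number :: "nat list \<Rightarrow> int" where
  "vector_partition_number ns =
     mfps_coeff (vector_partition_series (length ns)) (Poly_Mapping.nth ns)"

end

theory Submission
  imports Defs "HOL-Library.Multiset"
begin

text \<open>
  The local drops \<open>a\<^sub>i = \<pi>\<^sub>i - max\<^sub>k \<pi>\<^bsub>i+e\<^sub>k\<^esub>\<close> determine a \<open>d\<close>-dimensional partition \<open>\<pi>\<close>, by downward
  recursion on \<open>i\<close>. Since \<open>a\<^sub>i \<le> \<pi>\<^sub>i - \<pi>\<^bsub>i+e\<^sub>k\<^esub>\<close>, Abel summation along the \<open>k\<close>-th direction gives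
  \<open>\<Sum>\<^sub>i i\<^sub>k a\<^sub>i \<le> |\<pi>|\<close>. Hence taking the vector \<open>i\<close> with multiplicity \<open>a\<^sub>i\<close> encodes \<open>\<pi>\<close> by a
  multiset of vectors whose sum lies in \<open>{1..n}\<^sup>d\<close>. Increasing the lexicographically largest vector
  of the multiset makes the sum equal to \<open>(n, \<dots>, n)\<close>; this step is injective once the original sum
  is recorded, which costs a factor \<open>n\<^sup>d\<close>.
\<close>

section \<open>Coefficients of the vector partition series\<close>

text \<open>For exponent vectors these are the vector partitions of \<open>m\<close> with parts in
  \<open>F\<close>, the objects counted by the coefficients of the product.\<close>

definition msets_of_sum :: "'a::comm_monoid_add set \<Rightarrow> 'a \<Rightarrow> 'a multiset set" where
  "msets_of_sum F m = {A. set_mset A \<subseteq> F \<and> \<Sum>\<^sub># A = m}"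

text \<open>Either \<open>i\<close> does not occur, or one copy of it can be removed. By
  cancellation \<open>b\<close> is unique if it exists, so the union replaces a case distinction on
  whether \<open>i\<close> can be subtracted from \<open>m\<close>.\<close>

lemma msets_of_sum_insert:
  fixes i :: "'a::cancel_comm_monoid_add"
  assumes "i \<notin> F"
  shows "msets_of_sum (insert i F) m =
    msets_of_sum F m \<union> (\<Union>b\<in>{b. i + b = m}. add_mset i ` msets_of_sum (insert i F) b)"
proof (intro equalityI subsetI)
  fix A assume A: "A \<in> msets_of_sum (insert i F) m"
  show "A \<in> msets_of_sum F m \<union> (\<Union>b\<in>{b. i + b = m}. add_mset i ` msets_of_sum (insert i F) b)"
  proof (cases "i \<in># A")
    case True
    then obtain B where "A = add_mset i B" by (metis insert_DiffM)
    then show ?thesis using A by (auto simp: msets_of_sum_def)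
  qed (use A in \<open>auto simp: msets_of_sum_def\<close>)
qed (auto simp: msets_of_sum_def)

text \<open>Each nonzero part adds at least 1 to the total degree, so the degree of \<open>m\<close>
  bounds the number of parts.\<close>

lemma finite_msets_of_sum:
  fixes F :: "(nat \<Rightarrow>\<^sub>0 nat) set"
  assumes "finite F" "0 \<notin> F"
  shows "finite (msets_of_sum F m)"
proof -
  \<comment> \<open>Total degree restricted to the variables of \<open>m\<close>: a finite sum,
    additive, and still positive on every part, since exponents in a sum cannot cancel.\<close>
  define s where "s = (\<lambda>i::nat \<Rightarrow>\<^sub>0 nat. \<Sum>k\<in>Poly_Mapping.keys m. Poly_Mapping.lookup i k)"
  have bound: "size A \<le> s m" if A: "A \<in> msets_of_sum F m" for A
  proof -
    have s_add: "s (a + b) = s a + s b" for a b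
      by (simp add: s_def lookup_add sum.distrib)
    have s_sum: "s (\<Sum>\<^sub># B) = (\<Sum>x\<in>#B. s x)" for B
    proof (induction B)
      case empty
      show ?case by (simp add: s_def)
    qed (simp add: s_add)
    have "1 \<le> s x" if x: "x \<in># A" for x
    proof -
      have B: "m = x + \<Sum>\<^sub># (A - {#x#})"
        using A sum_mset.remove[OF x] by (simp add: msets_of_sum_def)
      have "x \<noteq> 0" using A x assms(2) by (auto simp: msets_of_sum_def)
      then obtain k where k: "Poly_Mapping.lookup x k \<noteq> 0"
        using poly_mapping_eqI[of x 0] by auto
      then have "k \<in> Poly_Mapping.keys m"
        by (simp add: B in_keys_iff lookup_add)
      then have "Poly_Mapping.lookup x k \<le> s x"
        unfolding s_def by (intro member_le_sum) auto
      then show ?thesis using k by simp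
    qed
    then have "(\<Sum>x\<in>#A. 1) \<le> (\<Sum>x\<in>#A. s x)" by (intro sum_mset_mono)
    also have "\<dots> = s m" using A s_sum[of A] by (auto simp: msets_of_sum_def)
    finally show ?thesis by simp
  qed
  have "msets_of_sum F m \<subseteq> mset ` {xs. set xs \<subseteq> F \<and> length xs \<le> s m}"
  proof
    fix A assume A: "A \<in> msets_of_sum F m"
    obtain xs where "mset xs = A" using ex_mset by blast
    then show "A \<in> mset ` {xs. set xs \<subseteq> F \<and> length xs \<le> s m}"
      using A bound[OF A] by (auto simp: msets_of_sum_def)
  qed
  moreover have "finite {xs. set xs \<subseteq> F \<and> length xs \<le> s m}"
    using assms(1) by (rule finite_lists_length_le)
  ultimately show ?thesis by (meson finite_imageI finite_subset)
qed

lemma mfps_coeff_monom_mult: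
  fixes P :: "'a::comm_ring_1 mfps"
  shows "mfps_coeff (mfps_monom i * P) m = (\<Sum>b\<in>{b. i + b = m}. mfps_coeff P b)"
proof (cases "\<exists>b. i + b = m")
  case True
  then obtain b where b: "i + b = m" by blast
  then have "{b. i + b = m} = {b}" by auto
  then show ?thesis
    unfolding times_mfps_def mfps_coeff_Abs
    by (subst sum_decompositions_single[OF b]) (auto simp: mfps_monom_def)
next
  case False
  then show ?thesis
    by (auto simp: times_mfps_def mfps_monom_def intro!: sum.neutral)
qed

text \<open>Induction on \<open>F\<close>: splitting off one copy of \<open>i\<close> says that the
  counting series for \<open>insert i F\<close>, times \<open>1 - mfps_monom i\<close>, is the one
  for \<open>F\<close>. Multiplying by the inverse adds the factor of \<open>i\<close>.\<close>

lemma mfps_coeff_prod_inverse: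
  assumes "finite F" "0 \<notin> F"
  shows "mfps_coeff (\<Prod>i\<in>F. mfps_inverse (1 - mfps_monom i) :: 'a::comm_ring_1 mfps) m =
    of_nat (card (msets_of_sum F m))"
proof -
  let ?P = "\<lambda>F. Abs_mfps (\<lambda>m. of_nat (card (msets_of_sum F m))) :: 'a mfps"
  have "(\<Prod>i\<in>F. mfps_inverse (1 - mfps_monom i)) = ?P F"
    using assms
  proof (induction F rule: finite_induct)
    case empty
    have "msets_of_sum {} m = (if m = 0 then {{#}} else {})" for m :: "nat \<Rightarrow>\<^sub>0 nat"
      by (auto simp: msets_of_sum_def)
    then show ?case by (intro mfps_eqI) (simp add: one_mfps_def)
  next
    case (insert i F)
    have fin: "finite (msets_of_sum (insert i F) b)" for b
      using insert by (intro finite_msets_of_sum) auto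
    have P: "(1 - mfps_monom i) * ?P (insert i F) = ?P F"
    proof (rule mfps_eqI)
      fix m
      let ?B = "{b. i + b = m}"
      have B: "finite ?B"
        by (rule finite_subset[of _ "snd ` {(a, b). a + b = m}"])
          (force simp: finite_decompositions)+
      have "card (msets_of_sum (insert i F) m) =
          card (msets_of_sum F m) + card (\<Union>b\<in>?B. add_mset i ` msets_of_sum (insert i F) b)"
        using insert fin B
        by (subst msets_of_sum_insert)
          (auto intro!: card_Un_disjoint finite_msets_of_sum, auto simp: msets_of_sum_def)
      also have "card (\<Union>b\<in>?B. add_mset i ` msets_of_sum (insert i F) b) =
          (\<Sum>b\<in>?B. card (add_mset i ` msets_of_sum (insert i F) b))"
        using B fin by (intro card_UN_disjoint) (auto simp: msets_of_sum_def)
      also have "\<dots> = (\<Sum>b\<in>?B. card (msets_of_sum (insert i F) b))"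
        by (intro sum.cong refl card_image) (simp add: inj_on_def)
      finally have rec: "of_nat (card (msets_of_sum (insert i F) m)) =
          of_nat (card (msets_of_sum F m)) +
          (\<Sum>b\<in>?B. of_nat (card (msets_of_sum (insert i F) b)) :: 'a)"
        by simp
      have "mfps_coeff ((1 - mfps_monom i) * ?P (insert i F)) m =
          mfps_coeff (?P (insert i F)) m - mfps_coeff (mfps_monom i * ?P (insert i F)) m"
        by (simp add: left_diff_distrib) (simp add: minus_mfps_def)
      then show "mfps_coeff ((1 - mfps_monom i) * ?P (insert i F)) m = mfps_coeff (?P F) m"
        unfolding mfps_coeff_monom_mult by (simp add: rec)
    qed
    have inv: "(1 - mfps_monom i) * mfps_inverse (1 - mfps_monom i) = (1 :: 'a mfps)"
      using insert.prems by (intro mult_mfps_inverse) auto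
    have "mfps_inverse (1 - mfps_monom i) * ?P F =
        ((1 - mfps_monom i) * mfps_inverse (1 - mfps_monom i)) * ?P (insert i F)"
      unfolding P[symmetric] by (simp only: ac_simps)
    then have "mfps_inverse (1 - mfps_monom i) * ?P F = ?P (insert i F)"
      by (simp only: inv mult_1)
    then show ?case using insert by simp
  qed
  then show ?thesis by simp
qed

lemma msets_of_sum_pos_index:
  assumes "d \<ge> 1"
  shows "finite (msets_of_sum (pos_index d) m)"
    and "mfps_coeff (vector_partition_series d) m = int (card (msets_of_sum (pos_index d) m))"
proof -
  have 0: "0 \<notin> pos_index d" using assms by (auto simp: pos_index_def intro!: exI[of _ 0])
  have "\<forall>\<^sub>F F in finite_subsets_at_top (pos_index d).
      mfps_coeff (\<Prod>i\<in>F. mfps_inverse (1 - mfps_monom i)) m =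
      mfps_coeff (vector_partition_series d) m"
    using vector_partition_series[OF assms] unfolding has_mfps_prod_def by blast
  then obtain X where X: "finite X" "X \<subseteq> pos_index d"
    and eq: "\<And>Y. finite Y \<Longrightarrow> X \<subseteq> Y \<Longrightarrow> Y \<subseteq> pos_index d \<Longrightarrow>
      mfps_coeff (\<Prod>i\<in>Y. mfps_inverse (1 - mfps_monom i)) m =
      mfps_coeff (vector_partition_series d) m"
    unfolding eventually_finite_subsets_at_top by metis
  \<comment> \<open>Beyond \<open>X\<close> the coefficient at \<open>m\<close> is constant; the
    second set contains every possible part of \<open>m\<close>. So over \<open>F\<close> both the
    product and the multisets already agree with those over \<open>pos_index d\<close>.\<close>
  define F where "F = X \<union> {i \<in> pos_index d. \<exists>c. i + c = m}"
  have "finite {i \<in> pos_index d. \<exists>c. i + c = m}"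
    by (rule finite_subset[of _ "fst ` {(a, b). a + b = m}"])
      (force simp: finite_decompositions)+
  then have F: "finite F" "F \<subseteq> pos_index d" "X \<subseteq> F"
    using X by (auto simp: F_def)
  have "x \<in> F" if "set_mset A \<subseteq> pos_index d" "\<Sum>\<^sub># A = m" "x \<in># A" for A x
  proof -
    have "x + \<Sum>\<^sub># (A - {#x#}) = m"
      using that sum_mset.remove by metis
    then show ?thesis using that by (auto simp: F_def)
  qed
  then have same: "msets_of_sum (pos_index d) m = msets_of_sum F m"
    using F(2) by (fastforce simp: msets_of_sum_def)
  have "0 \<notin> F" using F(2) 0 by blast
  then show "finite (msets_of_sum (pos_index d) m)"
    and "mfps_coeff (vector_partition_series d) m = int (card (msets_of_sum (pos_index d) m))"
    using F eq[of F] unfolding same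
    by (simp_all add: finite_msets_of_sum mfps_coeff_prod_inverse)
qed

section \<open>Raising the largest element of a multiset\<close>

definition raise_Max :: "'a::{linorder,plus} \<Rightarrow> 'a multiset \<Rightarrow> 'a multiset" where
  "raise_Max v A = add_mset (Max_mset A + v) (A - {#Max_mset A#})"

text \<open>As \<open>v\<close> is nonnegative, the raised element is still the largest one. It can
  therefore be located in the result and lowered by \<open>v\<close> again.\<close>

lemma raise_Max_inject:
  fixes v :: "'a::{linordered_cancel_ab_semigroup_add,comm_monoid_add}"
  assumes "A \<noteq> {#}" "B \<noteq> {#}" "0 \<le> v" "raise_Max v A = raise_Max v B"
  shows "A = B"
proof -
  have Max: "Max_mset (raise_Max v C) = Max_mset C + v" if "C \<noteq> {#}" for C
  proof (rule Max_eqI)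
    fix x assume "x \<in># raise_Max v C"
    then have "x = Max_mset C + v \<or> x \<in># C"
      by (auto simp: raise_Max_def dest: in_diffD)
    moreover have "Max_mset C \<le> Max_mset C + v"
      using add_left_mono[OF assms(3), of "Max_mset C"] by simp
    ultimately show "x \<le> Max_mset C + v"
      by (metis Max_ge finite_set_mset order.refl order.trans)
  qed (auto simp: raise_Max_def)
  have eq: "Max_mset A = Max_mset B"
    using Max[OF assms(1)] Max[OF assms(2)] assms(4) by simp
  then have "A - {#Max_mset A#} = B - {#Max_mset B#}"
    using assms(4) by (simp add: raise_Max_def)
  moreover have "Max_mset A \<in># A" "Max_mset B \<in># B"
    using assms by (auto intro: Max_in)
  ultimately show ?thesis using eq by (metis insert_DiffM)
qed

lemma sum_raise_Max:
  fixes v :: "'a::{linorder,comm_monoid_add}"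
  assumes "A \<noteq> {#}"
  shows "\<Sum>\<^sub># (raise_Max v A) = \<Sum>\<^sub># A + v"
proof -
  have "Max_mset A \<in># A" using assms by (auto intro: Max_in)
  then have "\<Sum>\<^sub># A = Max_mset A + \<Sum>\<^sub># (A - {#Max_mset A#})"
    by (rule sum_mset.remove)
  then show ?thesis by (simp add: raise_Max_def ac_simps)
qed

text \<open>A vector lexicographically below 0 would have a negative first nonzero entry.\<close>

lemma exponent_nonneg: "0 \<le> (v :: nat \<Rightarrow>\<^sub>0 nat)"
proof -
  have "\<not> v < 0" by transfer (simp add: less_fun_def)
  then show ?thesis by simp
qed

section \<open>Encoding a partition by its local drops\<close>

text \<open>The maximum over the upper neighbours makes one number lie below the differences in all
  \<open>d\<close> directions while still determining \<open>p i\<close> from its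
  neighbours.\<close>

definition drop_at :: "nat \<Rightarrow> ((nat \<Rightarrow>\<^sub>0 nat) \<Rightarrow> nat) \<Rightarrow> (nat \<Rightarrow>\<^sub>0 nat) \<Rightarrow> nat" where
  "drop_at d p i = p i - Max ((\<lambda>k. p (i + Poly_Mapping.single k 1)) ` {..<d})"

lemma pos_index_add_single:
  "i \<in> pos_index d \<Longrightarrow> k < d \<Longrightarrow> i + Poly_Mapping.single k 1 \<in> pos_index d"
  by (auto simp: pos_index_def lookup_add lookup_single when_def)

lemma dim_partition_step:
  assumes "is_dim_partition d p" "i \<in> pos_index d" "k < d"
  shows "p (i + Poly_Mapping.single k 1) \<le> p i"
  using assms pos_index_add_single[OF assms(2,3)]
  unfolding is_dim_partition_def by (simp add: lookup_add)

lemma drop_at_le: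
  assumes "k < d"
  shows "drop_at d p i \<le> p i - p (i + Poly_Mapping.single k 1)"
  unfolding drop_at_def using assms by (intro diff_le_mono2 Max_ge) auto

lemma drop_at_eq_0: "p i = 0 \<Longrightarrow> drop_at d p i = 0"
  by (simp add: drop_at_def)

text \<open>Among the finitely many positions of disagreement take one with the largest coordinate
  sum. All its upper neighbours agree, so the drop there forces the values to agree too.\<close>

lemma drop_at_inject:
  assumes "d \<ge> 1" "is_dim_partition d p" "is_dim_partition d q" "drop_at d p = drop_at d q"
  shows "p = q"
proof (rule ccontr)
  assume "p \<noteq> q"
  define D where "D = {i. p i \<noteq> q i}"
  define s where "s i = (\<Sum>k<d. Poly_Mapping.lookup i k)" for i :: "nat \<Rightarrow>\<^sub>0 nat"
  have "finite ({i. p i \<noteq> 0} \<union> {i. q i \<noteq> 0})"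
    using assms by (simp add: is_dim_partition_def)
  then have "finite D" by (rule rev_finite_subset) (auto simp: D_def)
  moreover have "D \<noteq> {}" using \<open>p \<noteq> q\<close> by (auto simp: D_def)
  ultimately have "Max (s ` D) \<in> s ` D" by simp
  then obtain i where i: "i \<in> D" "Max (s ` D) = s i" by auto
  have max: "s j \<le> s i" if "j \<in> D" for j
    using that \<open>finite D\<close> unfolding i(2)[symmetric] by simp
  have "p (i + Poly_Mapping.single k 1) = q (i + Poly_Mapping.single k 1)" if "k < d" for k
  proof -
    have "s (i + Poly_Mapping.single k 1) = s i + 1"
      using that by (simp add: s_def lookup_add lookup_single when_def sum.distrib)
    then show ?thesis using max[of "i + Poly_Mapping.single k 1"] by (auto simp: D_def)
  qed
  then have eq: "(\<lambda>k. p (i + Poly_Mapping.single k 1)) ` {..<d} =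
      (\<lambda>k. q (i + Poly_Mapping.single k 1)) ` {..<d}"
    by auto
  have "i \<in> pos_index d"
    using i(1) assms(2,3) unfolding D_def is_dim_partition_def by (metis (mono_tags, lifting) mem_Collect_eq)
  \<comment> \<open>This makes the truncated subtraction in \<open>drop_at\<close> reversible;
    \<open>d \<ge> 1\<close> keeps the maximum from being over an empty set.\<close>
  then have le: "Max ((\<lambda>k. r (i + Poly_Mapping.single k 1)) ` {..<d}) \<le> r i"
    if "is_dim_partition d r" for r
    using assms(1) that dim_partition_step[OF that] by (subst Max_le_iff) (auto simp: lessThan_empty_iff)
  have "p i = q i"
    using fun_cong[OF assms(4), of i] le[OF assms(2)] le[OF assms(3)]
    unfolding drop_at_def eq by linarith
  then show False using i by (simp add: D_def)
qed

text \<open>Abel summation in direction \<open>k\<close>: the weights of \<open>p\<close> at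
  neighbouring points differ by 1, so each entry is left with weight 1.\<close>

lemma sum_drop_at_le_volume:
  assumes "is_dim_partition d p" "k < d"
  shows "(\<Sum>i | p i \<noteq> 0. drop_at d p i * Poly_Mapping.lookup i k) \<le> volume p"
proof -
  let ?S = "{i. p i \<noteq> 0}" and ?l = "\<lambda>i. Poly_Mapping.lookup i k"
  let ?e = "Poly_Mapping.single k (1::nat)"
  have fin: "finite ?S" and pos: "?S \<subseteq> pos_index d"
    using assms(1) by (auto simp: is_dim_partition_def)
  have l1: "?l i \<ge> 1" if "i \<in> ?S" for i
    using that pos assms(2) by (auto simp: pos_index_def)
  \<comment> \<open>Terms with \<open>?l j = 1\<close> vanish. Any other \<open>j\<close> in the
    support is a shift of \<open>j - ?e\<close>, which is in the support by monotonicity.\<close>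
  have "(\<Sum>j\<in>?S. (?l j - 1) * p j) \<le> (\<Sum>j\<in>(\<lambda>i. i + ?e) ` ?S. (?l j - 1) * p j)"
  proof -
    have "j \<in> (\<lambda>i. i + ?e) ` ?S" if j: "j \<in> ?S" "?l j \<noteq> 1" for j
    proof -
      have l: "?l j \<ge> 2" using l1[OF j(1)] j(2) by simp
      define i where "i = j - ?e"
      have ij: "j = i + ?e"
        using l by (intro poly_mapping_eqI) (auto simp: i_def lookup_add lookup_minus lookup_single when_def)
      moreover have "i \<in> pos_index d"
        using j l pos by (auto simp: i_def pos_index_def lookup_minus lookup_single when_def)
      then have "p j \<le> p i"
        unfolding ij by (rule dim_partition_step[OF assms(1) _ assms(2)])
      ultimately show ?thesis using j by auto
    qed
    then have "(\<Sum>j\<in>?S. (?l j - 1) * p j) = (\<Sum>j\<in>?S \<inter> (\<lambda>i. i + ?e) ` ?S. (?l j - 1) * p j)"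
      using fin by (intro sum.mono_neutral_right) auto
    also have "\<dots> \<le> (\<Sum>j\<in>(\<lambda>i. i + ?e) ` ?S. (?l j - 1) * p j)"
      using fin by (intro sum_mono2) auto
    finally show ?thesis .
  qed
  also have "\<dots> = (\<Sum>i\<in>?S. ?l i * p (i + ?e))"
    by (subst sum.reindex) (auto simp: inj_on_def lookup_add)
  finally have shift: "(\<Sum>j\<in>?S. (?l j - 1) * p j) \<le> (\<Sum>i\<in>?S. ?l i * p (i + ?e))" .
  \<comment> \<open>Stated as a sum rather than a difference, to stay clear of truncated
    subtraction.\<close>
  have "(\<Sum>i\<in>?S. drop_at d p i * ?l i) + (\<Sum>i\<in>?S. ?l i * p (i + ?e)) \<le> (\<Sum>i\<in>?S. ?l i * p i)"
    unfolding sum.distrib[symmetric]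
  proof (rule sum_mono)
    fix i assume "i \<in> ?S"
    then have "drop_at d p i + p (i + ?e) \<le> p i"
      using drop_at_le[OF assms(2), of p i] dim_partition_step[OF assms(1) _ assms(2), of i] pos
      by fastforce
    then show "drop_at d p i * ?l i + ?l i * p (i + ?e) \<le> ?l i * p i"
      by (metis add_mult_distrib2 mult.commute mult_le_mono2)
  qed
  also have "(\<Sum>i\<in>?S. ?l i * p i) = (\<Sum>i\<in>?S. (?l i - 1) * p i) + volume p"
    unfolding volume_def sum.distrib[symmetric] using l1
    by (intro sum.cong refl) (simp add: diff_mult_distrib)
  finally show ?thesis using shift by linarith
qed

text \<open>The drop at \<open>i\<close> becomes the multiplicity of \<open>i\<close>.
  \<open>Abs_multiset\<close> is meaningful here when the drops have finite support, as they do for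
  a partition.\<close>

definition drop_mset :: "nat \<Rightarrow> ((nat \<Rightarrow>\<^sub>0 nat) \<Rightarrow> nat) \<Rightarrow> (nat \<Rightarrow>\<^sub>0 nat) multiset" where
  "drop_mset d p = Abs_multiset (drop_at d p)"

lemma count_drop_mset:
  assumes "is_dim_partition d p"
  shows "count (drop_mset d p) = drop_at d p"
  unfolding drop_mset_def
proof (rule count_Abs_multiset)
  have "{i. drop_at d p i > 0} \<subseteq> {i. p i \<noteq> 0}" by (auto simp: drop_at_eq_0 intro!: gr0I)
  then show "finite {i. drop_at d p i > 0}"
    using assms by (simp add: is_dim_partition_def finite_subset)
qed

lemma drop_mset_inject:
  assumes "d \<ge> 1" "is_dim_partition d p" "is_dim_partition d q" "drop_mset d p = drop_mset d q"
  shows "p = q"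
  using assms drop_at_inject count_drop_mset by metis

lemma set_drop_mset:
  assumes "is_dim_partition d p"
  shows "set_mset (drop_mset d p) \<subseteq> {i. p i \<noteq> 0}" "set_mset (drop_mset d p) \<subseteq> pos_index d"
proof -
  show *: "set_mset (drop_mset d p) \<subseteq> {i. p i \<noteq> 0}"
    by (auto simp: set_mset_def count_drop_mset[OF assms] drop_at_eq_0 intro!: gr0I)
  then show "set_mset (drop_mset d p) \<subseteq> pos_index d"
    using assms unfolding is_dim_partition_def by fastforce
qed

lemma sum_mset_image_eq_sum_count:
  fixes f :: "'a \<Rightarrow> 'b::comm_semiring_1"
  assumes "finite S" "set_mset A \<subseteq> S"
  shows "(\<Sum>x\<in>#A. f x) = (\<Sum>x\<in>S. of_nat (count A x) * f x)"
  using assms(2)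
proof (induction A)
  case (add a A)
  have "(\<Sum>x\<in>S. of_nat (count (add_mset a A) x) * f x) =
      (\<Sum>x\<in>S. (if x = a then f x else 0) + of_nat (count A x) * f x)"
    by (intro sum.cong refl) (simp add: algebra_simps)
  then show ?case using add assms(1) by (simp add: sum.distrib)
qed simp

lemma lookup_sum_mset:
  fixes A :: "('a \<Rightarrow>\<^sub>0 'b::comm_monoid_add) multiset"
  shows "Poly_Mapping.lookup (\<Sum>\<^sub># A) k = (\<Sum>i\<in>#A. Poly_Mapping.lookup i k)"
  by (induction A) (simp_all add: lookup_add)

lemma lookup_sum_drop_mset_le:
  assumes "is_dim_partition d p" "k < d"
  shows "Poly_Mapping.lookup (\<Sum>\<^sub># (drop_mset d p)) k \<le> volume p"
proof -
  have "Poly_Mapping.lookup (\<Sum>\<^sub># (drop_mset d p)) k =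
      (\<Sum>i | p i \<noteq> 0. drop_at d p i * Poly_Mapping.lookup i k)"
    using assms(1) set_drop_mset(1)[OF assms(1)]
    by (simp add: lookup_sum_mset sum_mset_image_eq_sum_count[of "{i. p i \<noteq> 0}"]
        count_drop_mset is_dim_partition_def)
  also have "\<dots> \<le> volume p" using assms by (rule sum_drop_at_le_volume)
  finally show ?thesis .
qed

text \<open>The zero array already has the empty multiset as its code, and the code is injective.
  Nonemptiness provides the maximum to be raised.\<close>

lemma drop_mset_nonempty:
  assumes "d \<ge> 1" "is_dim_partition d p" "volume p \<ge> 1"
  shows "drop_mset d p \<noteq> {#}"
proof
  assume "drop_mset d p = {#}"
  moreover have zero: "is_dim_partition d (\<lambda>i. 0)" by (simp add: is_dim_partition_def)
  then have "drop_mset d (\<lambda>i. 0) = {#}"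
    by (intro multiset_eqI) (simp add: count_drop_mset drop_at_eq_0)
  ultimately have "p = (\<lambda>i. 0)"
    using drop_mset_inject[OF assms(1,2) zero] by simp
  then show False using assms(3) by (simp add: volume_def)
qed

section \<open>The box of possible sums and the final injection\<close>

definition exponent_box :: "nat \<Rightarrow> nat \<Rightarrow> (nat \<Rightarrow>\<^sub>0 nat) set" where
  "exponent_box d n = {i \<in> pos_index d. \<forall>k<d. Poly_Mapping.lookup i k \<le> n}"

text \<open>Coordinates from \<open>d\<close> on are zero, so restricting to the first
  \<open>d\<close> embeds the box into the functions from \<open>{..<d}\<close> to
  \<open>{1..n}\<close>.\<close>

lemma exponent_box_bound: "finite (exponent_box d n)" "card (exponent_box d n) \<le> n ^ d"
proof -
  let ?r = "\<lambda>i. restrict (Poly_Mapping.lookup i) {..<d}"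
  have inj: "inj_on ?r (exponent_box d n)"
  proof (intro inj_onI poly_mapping_eqI)
    fix i j k assume ij: "i \<in> exponent_box d n" "j \<in> exponent_box d n" "?r i = ?r j"
    show "Poly_Mapping.lookup i k = Poly_Mapping.lookup j k"
    proof (cases "k < d")
      case True
      then show ?thesis using fun_cong[OF ij(3), of k] by simp
    qed (use ij in \<open>simp add: exponent_box_def pos_index_def\<close>)
  qed
  have sub: "?r ` exponent_box d n \<subseteq> (\<Pi>\<^sub>E k\<in>{..<d}. {1..n})"
    by (auto simp: exponent_box_def pos_index_def split: if_splits)
  have fin: "finite (\<Pi>\<^sub>E k\<in>{..<d}. {1..n})"
    by (intro finite_PiE) auto
  show "finite (exponent_box d n)" using inj sub fin by (rule inj_on_finite)
  have "card (exponent_box d n) \<le> card (\<Pi>\<^sub>E k\<in>{..<d}. {1..n})"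
    using inj sub fin by (rule card_inj_on_le)
  then show "card (exponent_box d n) \<le> n ^ d" by (simp add: card_PiE)
qed

text \<open>The upper bound is the Abel summation. The lower bound comes from any single part, whose
  entries are all at least 1; it makes the number of sums at most \<open>n ^ d\<close> instead of
  \<open>(n + 1) ^ d\<close>.\<close>

lemma sum_drop_mset_in_box:
  assumes "d \<ge> 1" "is_dim_partition d p" "volume p \<ge> 1"
  shows "\<Sum>\<^sub># (drop_mset d p) \<in> exponent_box d (volume p)"
proof -
  let ?A = "drop_mset d p"
  obtain x where x: "x \<in># ?A" using drop_mset_nonempty[OF assms] by (rule multiset_nonemptyE)
  have "Poly_Mapping.lookup (\<Sum>\<^sub># ?A) k \<ge> 1" if "k < d" for k
  proof -
    have "\<Sum>\<^sub># ?A = x + \<Sum>\<^sub># (?A - {#x#})" using x by (rule sum_mset.remove)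
    moreover have "Poly_Mapping.lookup x k \<ge> 1"
      using x that set_drop_mset(2)[OF assms(2)] by (auto simp: pos_index_def)
    ultimately show ?thesis by (simp add: lookup_add)
  qed
  moreover have "Poly_Mapping.lookup (\<Sum>\<^sub># ?A) k = 0" if "k \<ge> d" for k
    using that set_drop_mset(2)[OF assms(2)] by (auto simp: lookup_sum_mset pos_index_def)
  ultimately show ?thesis
    using lookup_sum_drop_mset_le[OF assms(2)] by (auto simp: exponent_box_def pos_index_def)
qed

theorem theorem1p2:
  fixes d n :: nat
  assumes "d \<ge> 1" and "n \<ge> 1"
  shows "int (num_dim_partitions d n) \<le> int n ^ d * vector_partition_number (replicate d n)"
proof -
  let ?\<Pi> = "{p. is_dim_partition d p \<and> volume p = n}"
  define N where "N = Poly_Mapping.nth (replicate d n)"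
  have N: "Poly_Mapping.lookup N k = (if k < d then n else 0)" for k
    by (simp add: N_def nth_default_def)
  let ?s = "\<lambda>p. \<Sum>\<^sub># (drop_mset d p)"
  \<comment> \<open>The first component records by how much the maximum was raised, which is needed
    to undo the raising.\<close>
  let ?f = "\<lambda>p. (?s p, raise_Max (N - ?s p) (drop_mset d p))"
  have box: "?s p \<in> exponent_box d n" and ne: "drop_mset d p \<noteq> {#}" if "p \<in> ?\<Pi>" for p
    using that assms sum_drop_mset_in_box[of d p] drop_mset_nonempty[of d p] by blast+
  have "inj_on ?f ?\<Pi>"
  proof (rule inj_onI)
    fix p q assume pq: "p \<in> ?\<Pi>" "q \<in> ?\<Pi>" "?f p = ?f q"
    then have "?s p = ?s q \<and>
        raise_Max (N - ?s p) (drop_mset d p) = raise_Max (N - ?s q) (drop_mset d q)"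
      by blast
    then have "raise_Max (N - ?s p) (drop_mset d p) = raise_Max (N - ?s p) (drop_mset d q)"
      by metis
    then have "drop_mset d p = drop_mset d q"
      by (rule raise_Max_inject[OF ne[OF pq(1)] ne[OF pq(2)] exponent_nonneg])
    then show "p = q" using pq drop_mset_inject[OF assms(1)] by blast
  qed
  moreover have "?f ` ?\<Pi> \<subseteq> exponent_box d n \<times> msets_of_sum (pos_index d) N"
  proof (rule image_subsetI)
    fix p assume p: "p \<in> ?\<Pi>"
    let ?A = "drop_mset d p"
    \<comment> \<open>The componentwise subtraction is exact because the sum lies in the
      box.\<close>
    have "?s p + (N - ?s p) = N"
      using box[OF p]
      by (intro poly_mapping_eqI)
        (auto simp: lookup_add lookup_minus N exponent_box_def pos_index_def)
    then have "\<Sum>\<^sub># (raise_Max (N - ?s p) ?A) = N"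
      using ne[OF p] by (simp add: sum_raise_Max)
    moreover have A: "set_mset ?A \<subseteq> pos_index d" using p set_drop_mset(2) by blast
    have "Max_mset ?A \<in> pos_index d"
      using A ne[OF p] Max_in[of "set_mset ?A"] by auto
    \<comment> \<open>Raising keeps the first \<open>d\<close> entries positive, and
      \<open>N - ?s p\<close> vanishes from \<open>d\<close> on because \<open>N\<close>
      does.\<close>
    then have "Max_mset ?A + (N - ?s p) \<in> pos_index d"
      by (auto simp: pos_index_def lookup_add lookup_minus N)
    then have "set_mset (raise_Max (N - ?s p) ?A) \<subseteq> pos_index d"
      using A by (auto simp: raise_Max_def dest: in_diffD)
    ultimately show "?f p \<in> exponent_box d n \<times> msets_of_sum (pos_index d) N"
      using box[OF p] by (simp add: msets_of_sum_def)
  qed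
  moreover have "finite (exponent_box d n \<times> msets_of_sum (pos_index d) N)"
    using assms(1) by (simp add: exponent_box_bound msets_of_sum_pos_index)
  ultimately have "card ?\<Pi> \<le> card (exponent_box d n \<times> msets_of_sum (pos_index d) N)"
    by (rule card_inj_on_le)
  also have "\<dots> \<le> n ^ d * card (msets_of_sum (pos_index d) N)"
    by (simp add: card_cartesian_product exponent_box_bound)
  finally have "int (num_dim_partitions d n) \<le> int (n ^ d * card (msets_of_sum (pos_index d) N))"
    unfolding num_dim_partitions_def by (rule of_nat_mono)
  then show ?thesis
    using msets_of_sum_pos_index(2)[OF assms(1), of N]
    by (simp add: vector_partition_number_def N_def)
qed

end
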